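(* Let $\theta\in\mathbb{R}\setminus\mathbb{Q}$. The scalar multiples $\lambda U^mV^n$ ($m,n\in\mathbb{Z}$, $\lambda\in\mathbb{C}$ with $|\lambda|=1$) are not global minima for the energy functional $\mathcal{L}_D=2E$ on the unitaries of $A_\theta^\infty$.
   Context: For irrational $\theta$, $A_\theta$ is the universal $C^*$-algebra generated by two unitaries $U,V$ with $UV=e^{2\pi i\theta}VU$; $\tau$ is its canonical tracial state ($\tau(U^mV^n)=0$ unless $(m,n)=(0,0)$), and $A_\theta^\infty$ is the smooth dense subalgebra (elements $\sum a_{m,n}U^mV^n$ with rapidly decreasing coefficients). $\delta_1,\delta_2$ are the $*$-derivations of $A_\theta^\infty$ determined by $\delta_1(U)=2\pi iU$, $\delta_1(V)=0$, $\delta_2(U)=0$, $\delta_2(V)=2\pi iV$. For a unitary $W\in A_\theta^\infty$ (equivalently, the field map, i.e. unital $*$-homomorphism, $C(\mathbb{T})\to A_\theta$ sending the canonical unitary generator to $W$), the energy is $\mathcal{L}_D(W)=2E(W)=\sum_{j=1}^2\tau\big(\delta_j(W)^*\delta_j(W)\big)$.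
   Formalization: The case m = n = 0 is excluded: the scalars λ·1 have energy 0, the least possible value, so they are global minima and the claim is false there; it is proved for all (m,n) ≠ (0,0) and all |λ| = 1. *)

theory Defs
  imports Complex_Main "HOL-Algebra.Module"
begin

section \<open>Unital C*-algebras\<close>

text \<open>
  Algebras are carrier-based records, as in HOL-Algebra; the scalars are the complex numbers.
  The locale does not exclude the zero algebra.
\<close>

record 'a cstar = "(complex, 'a) module" +
  star :: "'a \<Rightarrow> 'a"
  nrm :: "'a \<Rightarrow> real"

locale cstar_algebra = ring A for A :: "'a cstar" (structure) +
  assumes scale_closed: "x \<in> carrier A \<Longrightarrow> c \<odot> x \<in> carrier A"
    and scale_add_left: "x \<in> carrier A \<Longrightarrow> (c + d) \<odot> x = c \<odot> x \<oplus> d \<odot> x"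
    and scale_add_right:
      "\<lbrakk>x \<in> carrier A; y \<in> carrier A\<rbrakk> \<Longrightarrow> c \<odot> (x \<oplus> y) = c \<odot> x \<oplus> c \<odot> y"
    and scale_scale: "x \<in> carrier A \<Longrightarrow> c \<odot> (d \<odot> x) = (c * d) \<odot> x"
    and scale_one: "x \<in> carrier A \<Longrightarrow> 1 \<odot> x = x"
    and scale_mult_left:
      "\<lbrakk>x \<in> carrier A; y \<in> carrier A\<rbrakk> \<Longrightarrow> (c \<odot> x) \<otimes> y = c \<odot> (x \<otimes> y)"
    and scale_mult_right:
      "\<lbrakk>x \<in> carrier A; y \<in> carrier A\<rbrakk> \<Longrightarrow> x \<otimes> (c \<odot> y) = c \<odot> (x \<otimes> y)"
    and star_closed: "x \<in> carrier A \<Longrightarrow> star A x \<in> carrier A"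
    and star_star: "x \<in> carrier A \<Longrightarrow> star A (star A x) = x"
    and star_add:
      "\<lbrakk>x \<in> carrier A; y \<in> carrier A\<rbrakk> \<Longrightarrow> star A (x \<oplus> y) = star A x \<oplus> star A y"
    and star_scale: "x \<in> carrier A \<Longrightarrow> star A (c \<odot> x) = cnj c \<odot> star A x"
    and star_mult:
      "\<lbrakk>x \<in> carrier A; y \<in> carrier A\<rbrakk> \<Longrightarrow> star A (x \<otimes> y) = star A y \<otimes> star A x"
    and nrm_nonneg: "x \<in> carrier A \<Longrightarrow> 0 \<le> nrm A x"
    and nrm_eq_0: "x \<in> carrier A \<Longrightarrow> nrm A x = 0 \<longleftrightarrow> x = \<zero>"
    and nrm_triangle:
      "\<lbrakk>x \<in> carrier A; y \<in> carrier A\<rbrakk> \<Longrightarrow> nrm A (x \<oplus> y) \<le> nrm A x + nrm A y"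
    and nrm_scale: "x \<in> carrier A \<Longrightarrow> nrm A (c \<odot> x) = cmod c * nrm A x"
    and nrm_mult: "\<lbrakk>x \<in> carrier A; y \<in> carrier A\<rbrakk> \<Longrightarrow> nrm A (x \<otimes> y) \<le> nrm A x * nrm A y"
    and cstar_identity: "x \<in> carrier A \<Longrightarrow> nrm A (star A x \<otimes> x) = (nrm A x)\<^sup>2"
    and complete:
      "\<lbrakk>\<And>n::nat. X n \<in> carrier A;
        \<forall>e>0. \<exists>N. \<forall>m\<ge>N. \<forall>n\<ge>N. nrm A (X m \<ominus> X n) < e\<rbrakk>
       \<Longrightarrow> \<exists>x\<in>carrier A. (\<lambda>n. nrm A (X n \<ominus> x)) \<longlonglongrightarrow> 0"

definition unitaries :: "'a cstar \<Rightarrow> 'a set" where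
  "unitaries A = {w \<in> carrier A.
     star A w \<otimes>\<^bsub>A\<^esub> w = \<one>\<^bsub>A\<^esub> \<and> w \<otimes>\<^bsub>A\<^esub> star A w = \<one>\<^bsub>A\<^esub>}"

definition star_hom :: "'a cstar \<Rightarrow> 'b cstar \<Rightarrow> ('a \<Rightarrow> 'b) set" where
  "star_hom A B = {\<phi> \<in> ring_hom A B.
     \<forall>x\<in>carrier A. (\<forall>c. \<phi> (c \<odot>\<^bsub>A\<^esub> x) = c \<odot>\<^bsub>B\<^esub> \<phi> x) \<and> \<phi> (star A x) = star B (\<phi> x)}"

definition closed_star_subalgebra :: "'a cstar \<Rightarrow> 'a set \<Rightarrow> bool" where
  "closed_star_subalgebra A S \<longleftrightarrow>
     S \<subseteq> carrier A \<and> \<one>\<^bsub>A\<^esub> \<in> S \<and>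
     (\<forall>x\<in>S. \<forall>y\<in>S. x \<oplus>\<^bsub>A\<^esub> y \<in> S \<and> x \<otimes>\<^bsub>A\<^esub> y \<in> S) \<and>
     (\<forall>x\<in>S. star A x \<in> S \<and> (\<forall>c. c \<odot>\<^bsub>A\<^esub> x \<in> S)) \<and>
     (\<forall>X x. (\<forall>n::nat. X n \<in> S) \<and> x \<in> carrier A \<and> (\<lambda>n. nrm A (X n \<ominus>\<^bsub>A\<^esub> x)) \<longlonglongrightarrow> 0
        \<longrightarrow> x \<in> S)"

definition has_nrm_sum :: "'a cstar \<Rightarrow> ('i \<Rightarrow> 'a) \<Rightarrow> 'a \<Rightarrow> bool" where
  "has_nrm_sum A f x \<longleftrightarrow>
     ((\<lambda>F. nrm A ((\<Oplus>\<^bsub>A\<^esub>i\<in>F. f i) \<ominus>\<^bsub>A\<^esub> x)) \<longlongrightarrow> 0) (finite_subsets_at_top UNIV)"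


section \<open>The rotation algebra and its smooth subalgebra\<close>

definition rotation_pair :: "real \<Rightarrow> 'a cstar \<Rightarrow> 'a \<Rightarrow> 'a \<Rightarrow> bool" where
  "rotation_pair \<theta> A u v \<longleftrightarrow> u \<in> unitaries A \<and> v \<in> unitaries A \<and>
     u \<otimes>\<^bsub>A\<^esub> v = exp (2 * of_real pi * \<i> * of_real \<theta>) \<odot>\<^bsub>A\<^esub> (v \<otimes>\<^bsub>A\<^esub> u)"

text \<open>
  The universal C*-algebra generated by two unitaries satisfying the rotation relation.
  A formula cannot quantify over types, so the universal property is tested on all C*-algebras
  whose carrier is a set of complex numbers (with arbitrary operations). This loses nothing: the
  C*-subalgebra generated by two elements of any C*-algebra is separable, hence has at most
  continuum many elements and is isomorphic to one of these. The homomorphism is unique because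
  \<open>U\<close> and \<open>V\<close> generate \<open>A\<close>.
\<close>

definition rotation_algebra :: "real \<Rightarrow> 'a cstar \<Rightarrow> 'a \<Rightarrow> 'a \<Rightarrow> bool" where
  "rotation_algebra \<theta> A U V \<longleftrightarrow>
     cstar_algebra A \<and> rotation_pair \<theta> A U V \<and>
     (\<forall>S. closed_star_subalgebra A S \<and> U \<in> S \<and> V \<in> S \<longrightarrow> S = carrier A) \<and>
     (\<forall>(B :: complex cstar) u v. cstar_algebra B \<and> rotation_pair \<theta> B u v
        \<longrightarrow> (\<exists>\<phi>\<in>star_hom A B. \<phi> U = u \<and> \<phi> V = v))"

definition monomial :: "'a cstar \<Rightarrow> 'a \<Rightarrow> 'a \<Rightarrow> int \<Rightarrow> int \<Rightarrow> 'a" where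
  "monomial A U V m n = U [^]\<^bsub>A\<^esub> m \<otimes>\<^bsub>A\<^esub> V [^]\<^bsub>A\<^esub> n"

definition rapidly_decreasing :: "(int \<Rightarrow> int \<Rightarrow> complex) \<Rightarrow> bool" where
  "rapidly_decreasing a \<longleftrightarrow>
     (\<forall>k::nat. \<exists>C. \<forall>m n. (1 + \<bar>real_of_int m\<bar> + \<bar>real_of_int n\<bar>) ^ k * cmod (a m n) \<le> C)"

definition smooth_elements :: "'a cstar \<Rightarrow> 'a \<Rightarrow> 'a \<Rightarrow> 'a set" where
  "smooth_elements A U V = {x \<in> carrier A. \<exists>a. rapidly_decreasing a \<and>
     has_nrm_sum A (\<lambda>(m, n). a m n \<odot>\<^bsub>A\<^esub> monomial A U V m n) x}"

definition smooth_unitaries :: "'a cstar \<Rightarrow> 'a \<Rightarrow> 'a \<Rightarrow> 'a set" where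
  "smooth_unitaries A U V = unitaries A \<inter> smooth_elements A U V"


section \<open>Trace, derivations and energy\<close>

definition tracial_state :: "'a cstar \<Rightarrow> ('a \<Rightarrow> complex) \<Rightarrow> bool" where
  "tracial_state A \<tau> \<longleftrightarrow>
     (\<forall>x\<in>carrier A. \<forall>y\<in>carrier A. \<tau> (x \<oplus>\<^bsub>A\<^esub> y) = \<tau> x + \<tau> y) \<and>
     (\<forall>x\<in>carrier A. \<forall>c. \<tau> (c \<odot>\<^bsub>A\<^esub> x) = c * \<tau> x) \<and>
     (\<forall>x\<in>carrier A. \<tau> (star A x \<otimes>\<^bsub>A\<^esub> x) \<in> \<real> \<and> 0 \<le> Re (\<tau> (star A x \<otimes>\<^bsub>A\<^esub> x))) \<and>
     \<tau> \<one>\<^bsub>A\<^esub> = 1 \<and>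
     (\<forall>x\<in>carrier A. \<forall>y\<in>carrier A. \<tau> (x \<otimes>\<^bsub>A\<^esub> y) = \<tau> (y \<otimes>\<^bsub>A\<^esub> x))"

definition canonical_trace :: "'a cstar \<Rightarrow> 'a \<Rightarrow> 'a \<Rightarrow> ('a \<Rightarrow> complex) \<Rightarrow> bool" where
  "canonical_trace A U V \<tau> \<longleftrightarrow> tracial_state A \<tau> \<and>
     (\<forall>m n. (m, n) \<noteq> (0, 0) \<longrightarrow> \<tau> (monomial A U V m n) = 0)"

definition star_derivation :: "'a cstar \<Rightarrow> 'a set \<Rightarrow> ('a \<Rightarrow> 'a) \<Rightarrow> bool" where
  "star_derivation A S \<delta> \<longleftrightarrow>
     \<delta> \<in> S \<rightarrow> S \<and>
     (\<forall>x\<in>S. \<forall>y\<in>S. \<delta> (x \<oplus>\<^bsub>A\<^esub> y) = \<delta> x \<oplus>\<^bsub>A\<^esub> \<delta> y) \<and>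
     (\<forall>x\<in>S. \<forall>c. \<delta> (c \<odot>\<^bsub>A\<^esub> x) = c \<odot>\<^bsub>A\<^esub> \<delta> x) \<and>
     (\<forall>x\<in>S. \<forall>y\<in>S. \<delta> (x \<otimes>\<^bsub>A\<^esub> y) = \<delta> x \<otimes>\<^bsub>A\<^esub> y \<oplus>\<^bsub>A\<^esub> x \<otimes>\<^bsub>A\<^esub> \<delta> y) \<and>
     (\<forall>x\<in>S. \<delta> (star A x) = star A (\<delta> x))"

definition canonical_derivations ::
    "'a cstar \<Rightarrow> 'a \<Rightarrow> 'a \<Rightarrow> ('a \<Rightarrow> 'a) \<Rightarrow> ('a \<Rightarrow> 'a) \<Rightarrow> bool" where
  "canonical_derivations A U V \<delta>\<^sub>1 \<delta>\<^sub>2 \<longleftrightarrow>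
     star_derivation A (smooth_elements A U V) \<delta>\<^sub>1 \<and>
     star_derivation A (smooth_elements A U V) \<delta>\<^sub>2 \<and>
     \<delta>\<^sub>1 U = (2 * of_real pi * \<i>) \<odot>\<^bsub>A\<^esub> U \<and> \<delta>\<^sub>1 V = \<zero>\<^bsub>A\<^esub> \<and>
     \<delta>\<^sub>2 U = \<zero>\<^bsub>A\<^esub> \<and> \<delta>\<^sub>2 V = (2 * of_real pi * \<i>) \<odot>\<^bsub>A\<^esub> V"

text \<open>
  The energy \<open>L_D = 2E\<close>. Both summands are nonnegative reals by positivity of the trace, so taking
  real parts only changes the type.
\<close>

definition energy ::
    "'a cstar \<Rightarrow> ('a \<Rightarrow> complex) \<Rightarrow> ('a \<Rightarrow> 'a) \<Rightarrow> ('a \<Rightarrow> 'a) \<Rightarrow> 'a \<Rightarrow> real" where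
  "energy A \<tau> \<delta>\<^sub>1 \<delta>\<^sub>2 W =
     Re (\<tau> (star A (\<delta>\<^sub>1 W) \<otimes>\<^bsub>A\<^esub> \<delta>\<^sub>1 W) + \<tau> (star A (\<delta>\<^sub>2 W) \<otimes>\<^bsub>A\<^esub> \<delta>\<^sub>2 W))"

text \<open>
  Minimality is over all smooth unitaries, not within one connected component. The scalars, i.e. the
  multiples of \<open>monomial A U V 0 0\<close>, have energy 0 and so are global minima.
\<close>

definition global_minimum ::
    "'a cstar \<Rightarrow> 'a \<Rightarrow> 'a \<Rightarrow> ('a \<Rightarrow> complex) \<Rightarrow> ('a \<Rightarrow> 'a) \<Rightarrow> ('a \<Rightarrow> 'a) \<Rightarrow> 'a \<Rightarrow> bool" where
  "global_minimum A U V \<tau> \<delta>\<^sub>1 \<delta>\<^sub>2 W \<longleftrightarrow>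
     is_arg_min (energy A \<tau> \<delta>\<^sub>1 \<delta>\<^sub>2) (\<lambda>W'. W' \<in> smooth_unitaries A U V) W"

end

theory Submission
  imports Defs
begin

text \<open>
  The minimal energy is \<open>0\<close>, attained at the unit: a derivation kills \<open>\<one>\<close>, by the Leibniz rule for
  \<open>\<one> \<otimes> \<one>\<close>. A nontrivial monomial has strictly larger energy. Indeed \<open>U\<close> and \<open>V\<close> are joint
  eigenvectors of the two derivations, and eigenvectors with purely imaginary eigenvalues are
  stable under products and under the star, with additive respectively negated imaginary parts. As
  the inverse of a unitary is its adjoint, this covers negative powers too, so \<open>U\<^sup>m V\<^sup>n\<close> is a
  joint eigenvector for \<open>2 \<pi> \<i> m\<close> and \<open>2 \<pi> \<i> n\<close> (lemma \<open>derivation_monomial\<close>). The trace of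
  \<open>W\<^sup>* W = \<one>\<close> is \<open>1\<close> for every unitary \<open>W\<close>, so a joint eigenvector which is unitary has as its
  energy the sum of the squared moduli of its eigenvalues, here \<open>4 \<pi>\<^sup>2 (m\<^sup>2 + n\<^sup>2)\<close>.
\<close>

context cstar_algebra
begin

lemma scale_zero_left [simp]:
  assumes x: "x \<in> carrier A"
  shows "0 \<odot> x = \<zero>"
proof -
  have "0 \<odot> x \<oplus> 0 \<odot> x = 0 \<odot> x"
    using scale_add_left[OF x, of 0 0] by simp
  then show ?thesis
    using x by (simp add: scale_closed)
qed

lemma star_one [simp]: "star A \<one> = \<one>"
proof -
  have "star A \<one> = star A (star A \<one> \<otimes> \<one>)"
    using star_mult[of "star A \<one>" \<one>] by (simp add: star_closed star_star)
  then show ?thesis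
    by (simp add: star_closed star_star)
qed

lemma unitaryD:
  assumes "w \<in> unitaries A"
  shows "w \<in> carrier A" "star A w \<otimes> w = \<one>" "w \<otimes> star A w = \<one>"
  using assms by (auto simp: unitaries_def)

lemma one_unitary: "\<one> \<in> unitaries A"
  by (simp add: unitaries_def)

lemma star_unitary: "w \<in> unitaries A \<Longrightarrow> star A w \<in> unitaries A"
  by (auto simp: unitaries_def star_closed star_star)

lemma mult_unitary:
  assumes v: "v \<in> unitaries A" and w: "w \<in> unitaries A"
  shows "v \<otimes> w \<in> unitaries A"
proof -
  note [simp] = unitaryD(1)[OF v] unitaryD(1)[OF w] star_closed
  have "star A w \<otimes> star A v \<otimes> (v \<otimes> w) = star A w \<otimes> (star A v \<otimes> v) \<otimes> w"
    by (simp add: m_assoc)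
  moreover have "v \<otimes> w \<otimes> (star A w \<otimes> star A v) = v \<otimes> (w \<otimes> star A w) \<otimes> star A v"
    by (simp add: m_assoc)
  ultimately show ?thesis
    by (simp add: unitaries_def star_mult unitaryD[OF v] unitaryD[OF w])
qed

lemma scale_unitary:
  assumes w: "w \<in> unitaries A" and l: "cmod l = 1"
  shows "l \<odot> w \<in> unitaries A"
proof -
  have "l * cnj l = 1"
    using l by (metis complex_norm_square of_real_1 one_power2)
  then show ?thesis
    using unitaryD[OF w]
    by (simp add: unitaries_def star_scale scale_closed star_closed scale_mult_left
        scale_mult_right scale_scale scale_one mult.commute)
qed

lemma inv_unitary:
  assumes "w \<in> unitaries A"
  shows "inv w = star A w"
  using unitaryD[OF assms] by (intro inv_char) (auto simp: star_closed)

lemma nat_pow_unitary: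
  assumes w: "w \<in> unitaries A"
  shows "w [^] (k::nat) \<in> unitaries A"
  by (induction k) (simp_all add: one_unitary mult_unitary w)

lemma int_pow_neg_unitary:
  assumes w: "w \<in> unitaries A"
  shows "w [^] (- int k) = star A (w [^] k)"
proof -
  have "w [^] (- int k) = inv (w [^] k)"
    by (cases "k = 0") (simp_all add: int_pow_def2)
  then show ?thesis
    by (simp add: inv_unitary nat_pow_unitary w)
qed

lemma int_pow_unitary:
  assumes w: "w \<in> unitaries A"
  shows "w [^] (k::int) \<in> unitaries A"
  by (cases k rule: int_cases2)
    (simp_all add: int_pow_int int_pow_neg_unitary star_unitary nat_pow_unitary w)

lemma monomial_unitary:
  assumes "U \<in> unitaries A" "V \<in> unitaries A"
  shows "monomial A U V m n \<in> unitaries A"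
  using assms by (simp add: monomial_def mult_unitary int_pow_unitary)

lemma has_nrm_sum_single:
  assumes carrier: "\<And>j. f j \<in> carrier A" and zero: "\<And>j. j \<noteq> i \<Longrightarrow> f j = \<zero>"
  shows "has_nrm_sum A f (f i)"
proof -
  have sum: "(\<Oplus>j\<in>F. f j) = f i" if "finite F" "i \<in> F" for F
  proof -
    have "(\<Oplus>j\<in>{i}. f j) = (\<Oplus>j\<in>F. f j)"
      by (rule add.finprod_mono_neutral_cong_left) (use that carrier zero in auto)
    then show ?thesis
      using carrier by simp
  qed
  have "\<forall>\<^sub>F F in finite_subsets_at_top UNIV. finite F \<and> i \<in> F"
    by (auto simp: eventually_finite_subsets_at_top intro!: exI[of _ "{i}"])
  then have "\<forall>\<^sub>F F in finite_subsets_at_top UNIV. nrm A ((\<Oplus>j\<in>F. f j) \<ominus> f i) = 0"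
    by eventually_elim (simp add: sum carrier nrm_eq_0 minus_eq r_neg)
  then show ?thesis
    unfolding has_nrm_sum_def by (rule tendsto_eventually)
qed

lemma scaled_monomial_smooth:
  assumes U: "U \<in> unitaries A" and V: "V \<in> unitaries A"
  shows "l \<odot> monomial A U V m n \<in> smooth_elements A U V"
proof -
  define a where "a = (\<lambda>i j. if i = m \<and> j = n then l else 0)"
  have mono: "monomial A U V i j \<in> carrier A" for i j
    using monomial_unitary[OF U V] unitaryD by blast
  have "rapidly_decreasing a"
    unfolding rapidly_decreasing_def
  proof
    fix k
    show "\<exists>C. \<forall>i j. (1 + \<bar>real_of_int i\<bar> + \<bar>real_of_int j\<bar>) ^ k * cmod (a i j) \<le> C"
      by (rule exI[of _ "(1 + \<bar>real_of_int m\<bar> + \<bar>real_of_int n\<bar>) ^ k * cmod l"])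
        (auto simp: a_def)
  qed
  moreover have "has_nrm_sum A (\<lambda>(i, j). a i j \<odot> monomial A U V i j)
      (l \<odot> monomial A U V m n)"
    using has_nrm_sum_single[of "\<lambda>(i, j). a i j \<odot> monomial A U V i j" "(m, n)"]
    by (simp add: a_def mono scale_closed split: prod.split)
  ultimately show ?thesis
    using mono by (auto simp: smooth_elements_def scale_closed)
qed

lemma monomial_smooth:
  assumes U: "U \<in> unitaries A" and V: "V \<in> unitaries A"
  shows "monomial A U V m n \<in> smooth_elements A U V"
  using scaled_monomial_smooth[OF assms, of 1] unitaryD(1)[OF monomial_unitary[OF assms]]
  by (simp add: scale_one)

lemma derivation_one:
  assumes \<delta>: "star_derivation A S \<delta>" and S: "S \<subseteq> carrier A" "\<one> \<in> S"
  shows "\<delta> \<one> = \<zero>"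
proof -
  have "\<delta> \<one> \<in> carrier A"
    using \<delta> S by (auto simp: star_derivation_def)
  moreover have "\<delta> (\<one> \<otimes> \<one>) = \<delta> \<one> \<otimes> \<one> \<oplus> \<one> \<otimes> \<delta> \<one>"
    using \<delta> S(2) unfolding star_derivation_def by blast
  ultimately show ?thesis
    by simp
qed

lemma derivation_mult_eigen:
  assumes \<delta>: "star_derivation A S \<delta>" and S: "S \<subseteq> carrier A" and xy: "x \<in> S" "y \<in> S"
    and x: "\<delta> x = (\<i> * of_real c) \<odot> x" and y: "\<delta> y = (\<i> * of_real d) \<odot> y"
  shows "\<delta> (x \<otimes> y) = (\<i> * of_real (c + d)) \<odot> (x \<otimes> y)"
proof -
  have "\<delta> (x \<otimes> y) = \<delta> x \<otimes> y \<oplus> x \<otimes> \<delta> y"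
    using \<delta> xy by (auto simp: star_derivation_def)
  then show ?thesis
    using S xy
    by (simp add: x y subset_iff scale_mult_left scale_mult_right distrib_left
        flip: scale_add_left)
qed

text \<open>
  The star is conjugate linear, and conjugation negates a purely imaginary eigenvalue.
\<close>

lemma derivation_star_eigen:
  assumes \<delta>: "star_derivation A S \<delta>" and S: "S \<subseteq> carrier A" and xS: "x \<in> S"
    and x: "\<delta> x = (\<i> * of_real c) \<odot> x"
  shows "\<delta> (star A x) = (\<i> * of_real (- c)) \<odot> star A x"
proof -
  have "\<delta> (star A x) = star A (\<delta> x)"
    using \<delta> xS by (auto simp: star_derivation_def)
  then show ?thesis
    using S xS by (auto simp: x star_scale)
qed

lemma derivation_nat_pow_eigen:
  assumes \<delta>: "star_derivation A S \<delta>" and S: "S \<subseteq> carrier A"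
    and xS: "x \<in> S" and pow: "\<And>k::nat. x [^] k \<in> S"
    and x: "\<delta> x = (\<i> * of_real c) \<odot> x"
  shows "\<delta> (x [^] (k::nat)) = (\<i> * of_real (k * c)) \<odot> (x [^] k)"
proof (induction k)
  case 0
  have "\<one> \<in> S"
    using pow[of 0] by simp
  then show ?case
    using derivation_one[OF \<delta> S] by simp
next
  case (Suc k)
  show ?case
    using derivation_mult_eigen[OF \<delta> S pow xS Suc x] by (simp add: algebra_simps)
qed

lemma derivation_int_pow_eigen:
  assumes \<delta>: "star_derivation A S \<delta>" and S: "S \<subseteq> carrier A"
    and w: "w \<in> unitaries A" and pow: "\<And>k::int. w [^] k \<in> S"
    and eigen: "\<delta> w = (\<i> * of_real c) \<odot> w"
  shows "\<delta> (w [^] (k::int)) = (\<i> * of_real (k * c)) \<odot> (w [^] k)"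
proof -
  have pow_nat: "w [^] (j::nat) \<in> S" for j
    using pow[of "int j"] by (simp add: int_pow_int)
  have "w \<in> S"
    using pow_nat[of 1] unitaryD(1)[OF w] by simp
  note nat = derivation_nat_pow_eigen[OF \<delta> S this pow_nat eigen]
  show ?thesis
  proof (cases k rule: int_cases2)
    case (nonneg j)
    then show ?thesis
      using nat[of j] by (simp add: int_pow_int)
  next
    case (nonpos j)
    then show ?thesis
      using derivation_star_eigen[OF \<delta> S pow_nat nat, of j]
      by (simp add: int_pow_neg_unitary[OF w])
  qed
qed

lemma derivation_monomial:
  assumes U: "U \<in> unitaries A" and V: "V \<in> unitaries A"
    and \<delta>: "star_derivation A (smooth_elements A U V) \<delta>"
    and eigen: "\<delta> U = (\<i> * of_real c) \<odot> U" "\<delta> V = (\<i> * of_real d) \<odot> V"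
  shows "\<delta> (l \<odot> monomial A U V m n) = (\<i> * of_real (m * c + n * d)) \<odot> (l \<odot> monomial A U V m n)"
proof -
  let ?S = "smooth_elements A U V"
  have S: "?S \<subseteq> carrier A"
    by (auto simp: smooth_elements_def)
  have pow: "U [^] (k::int) \<in> ?S" "V [^] (k::int) \<in> ?S" for k
    using monomial_smooth[OF U V, of k 0] monomial_smooth[OF U V, of 0 k]
      unitaryD(1)[OF int_pow_unitary[OF U]] unitaryD(1)[OF int_pow_unitary[OF V]]
    by (simp_all add: monomial_def)
  have mono: "monomial A U V m n \<in> ?S"
    by (rule monomial_smooth[OF U V])
  have "\<delta> (monomial A U V m n) = (\<i> * of_real (m * c + n * d)) \<odot> monomial A U V m n"
    unfolding monomial_def
    by (intro derivation_mult_eigen[OF \<delta> S] derivation_int_pow_eigen[OF \<delta> S] pow U V eigen)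
  moreover have "\<delta> (l \<odot> monomial A U V m n) = l \<odot> \<delta> (monomial A U V m n)"
    using \<delta> mono by (auto simp: star_derivation_def)
  ultimately show ?thesis
    using S mono by (simp add: subset_iff scale_scale mult.commute)
qed

lemma energy_joint_eigen:
  assumes \<tau>: "tracial_state A \<tau>" and W: "W \<in> unitaries A"
    and "\<delta>\<^sub>1 W = (\<i> * of_real c) \<odot> W" "\<delta>\<^sub>2 W = (\<i> * of_real d) \<odot> W"
  shows "energy A \<tau> \<delta>\<^sub>1 \<delta>\<^sub>2 W = c\<^sup>2 + d\<^sup>2"
proof -
  have "\<tau> (star A ((\<i> * of_real r) \<odot> W) \<otimes> ((\<i> * of_real r) \<odot> W)) = of_real (r\<^sup>2)" for r
    using unitaryD[OF W] \<tau>
    by (simp add: star_scale star_closed scale_closed scale_mult_left scale_mult_right scale_scale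
        tracial_state_def power2_eq_square mult_ac)
  then show ?thesis
    using assms by (simp add: energy_def)
qed

end

theorem corollary2p5:
  fixes \<theta> :: real and A :: "'a cstar" and U V :: 'a
    and \<tau> :: "'a \<Rightarrow> complex" and \<delta>\<^sub>1 \<delta>\<^sub>2 :: "'a \<Rightarrow> 'a"
  assumes "\<theta> \<notin> \<rat>"
    and "rotation_algebra \<theta> A U V"
    and "canonical_trace A U V \<tau>"
    and "canonical_derivations A U V \<delta>\<^sub>1 \<delta>\<^sub>2"
  shows "\<forall>(m::int) (n::int) (l::complex). cmod l = 1 \<and> (m, n) \<noteq> (0, 0) \<longrightarrow>
           l \<odot>\<^bsub>A\<^esub> monomial A U V m n \<in> smooth_unitaries A U V \<and>
           \<not> global_minimum A U V \<tau> \<delta>\<^sub>1 \<delta>\<^sub>2 (l \<odot>\<^bsub>A\<^esub> monomial A U V m n)"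
proof -
  interpret cstar_algebra A
    using assms(2) by (simp add: rotation_algebra_def)
  have U: "U \<in> unitaries A" and V: "V \<in> unitaries A"
    using assms(2) by (auto simp: rotation_algebra_def rotation_pair_def)
  have \<tau>: "tracial_state A \<tau>"
    using assms(3) by (simp add: canonical_trace_def)
  have \<delta>: "star_derivation A (smooth_elements A U V) \<delta>\<^sub>1"
      "star_derivation A (smooth_elements A U V) \<delta>\<^sub>2"
    and eigen: "\<delta>\<^sub>1 U = (\<i> * of_real (2 * pi)) \<odot>\<^bsub>A\<^esub> U" "\<delta>\<^sub>1 V = (\<i> * of_real 0) \<odot>\<^bsub>A\<^esub> V"
      "\<delta>\<^sub>2 U = (\<i> * of_real 0) \<odot>\<^bsub>A\<^esub> U" "\<delta>\<^sub>2 V = (\<i> * of_real (2 * pi)) \<odot>\<^bsub>A\<^esub> V"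
    using assms(4) unitaryD(1)[OF U] unitaryD(1)[OF V]
    by (simp_all add: canonical_derivations_def mult_ac)
  have smooth: "l \<odot>\<^bsub>A\<^esub> monomial A U V m n \<in> smooth_unitaries A U V" if "cmod l = 1" for l m n
    using that scaled_monomial_smooth[OF U V] scale_unitary[OF monomial_unitary[OF U V]]
    by (simp add: smooth_unitaries_def)
  have energy: "energy A \<tau> \<delta>\<^sub>1 \<delta>\<^sub>2 (l \<odot>\<^bsub>A\<^esub> monomial A U V m n) = (m * (2 * pi))\<^sup>2 + (n * (2 * pi))\<^sup>2"
    if "cmod l = 1" for l m n
  proof -
    have "energy A \<tau> \<delta>\<^sub>1 \<delta>\<^sub>2 (l \<odot>\<^bsub>A\<^esub> monomial A U V m n)
        = (m * (2 * pi) + real_of_int n * 0)\<^sup>2 + (real_of_int m * 0 + n * (2 * pi))\<^sup>2"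
      using \<tau> scale_unitary[OF monomial_unitary[OF U V] that]
        derivation_monomial[OF U V \<delta>(1) eigen(1,2)] derivation_monomial[OF U V \<delta>(2) eigen(3,4)]
      by (rule energy_joint_eigen)
    then show ?thesis
      by simp
  qed
  show ?thesis
  proof (intro allI impI conjI)
    fix m n :: int and l :: complex
    assume *: "cmod l = 1 \<and> (m, n) \<noteq> (0, 0)"
    then show "l \<odot>\<^bsub>A\<^esub> monomial A U V m n \<in> smooth_unitaries A U V"
      using smooth by blast
    \<comment> \<open>The monomial with exponents \<open>(0, 0)\<close> is the unit, the competitor of energy \<open>0\<close>.\<close>
    have "energy A \<tau> \<delta>\<^sub>1 \<delta>\<^sub>2 (1 \<odot>\<^bsub>A\<^esub> monomial A U V 0 0)
        < energy A \<tau> \<delta>\<^sub>1 \<delta>\<^sub>2 (l \<odot>\<^bsub>A\<^esub> monomial A U V m n)"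
      using * by (auto simp: energy sum_power2_gt_zero_iff)
    then show "\<not> global_minimum A U V \<tau> \<delta>\<^sub>1 \<delta>\<^sub>2 (l \<odot>\<^bsub>A\<^esub> monomial A U V m n)"
      using smooth[of 1 0 0] by (auto simp: global_minimum_def is_arg_min_def)
  qed
qed

end
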